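(* Let $S$ be a symmetric linear operator (not assumed densely defined or closed) in a real or complex Hilbert space $\mathcal{H}$. The following assertions are equivalent: (i) $S$ is selfadjoint. (ii) $\operatorname{ran}M_{S,S}=\mathcal{H}\times\mathcal{H}$. (iii) $G(S)^{\perp}\subseteq\operatorname{ran}M_{S,S}$. (iv) $\operatorname{ran}(I+S^2)=\mathcal{H}$. (v) $S^2$ is densely defined and selfadjoint: $(S^2)^*=S^2$.
   Context: Linear operators in $\mathcal{H}$ are defined on linear subspaces; products have natural domains, $\operatorname{dom}(S^2)=\{h\in\operatorname{dom}S:Sh\in\operatorname{dom}S\}$. $S$ is symmetric if $(Sh\mid h')=(h\mid Sh')$ for all $h,h'\in\operatorname{dom}S$ (no density of the domain required); $S$ is selfadjoint if it is densely defined and $S^*=S$ (equality including domains). $G(S)=\{(h,Sh): h\in\operatorname{dom}S\}$ is the graph, $\perp$ is taken in the product Hilbert space $\mathcal{H}\times\mathcal{H}$. $M_{S,S}$ is the operator in $\mathcal{H}\times\mathcal{H}$ with domain $\operatorname{dom}S\times\operatorname{dom}S$ given by $M_{S,S}(h,k)=(h-Sk,\,Sh+k)$. *)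

theory Defs
  imports "HOL-Analysis.Analysis"
begin

text \<open>
  Scalar fields. A commutative real normed division algebra is isomorphic to the reals or to the
  complex numbers (Gelfand-Mazur), and \<open>scalar_mult_cnj\<close> forces \<open>scalar_cnj\<close> to be the
  identity in the first case and complex conjugation in the second. Hence, up to isomorphism, this
  class has exactly the two instances given below.
\<close>

class real_or_complex = real_normed_field +
  fixes scalar_cnj :: "'a \<Rightarrow> 'a"
  assumes scalar_cnj_add: "scalar_cnj (x + y) = scalar_cnj x + scalar_cnj y"
    and scalar_cnj_mult: "scalar_cnj (x * y) = scalar_cnj x * scalar_cnj y"
    and scalar_cnj_cnj: "scalar_cnj (scalar_cnj x) = x"
    and scalar_mult_cnj: "x * scalar_cnj x = (norm x)\<^sup>2 *\<^sub>R 1"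

instantiation real :: real_or_complex
begin

definition scalar_cnj_real :: "real \<Rightarrow> real" where
  "scalar_cnj_real x = x"

instance
  by standard (auto simp: scalar_cnj_real_def power2_eq_square)

end

instantiation complex :: real_or_complex
begin

definition scalar_cnj_complex :: "complex \<Rightarrow> complex" where
  "scalar_cnj_complex x = cnj x"

instance
  by standard (auto simp: scalar_cnj_complex_def complex_norm_square[symmetric] scaleR_conv_of_real)

end

text \<open>
  Hilbert spaces over such a field. The norm, the topology and completeness come from the sort
  \<open>banach\<close>; \<open>ip_self\<close> says that the norm is the one induced by the inner product.
\<close>

locale hilbert_space = vector_space smul
  for smul :: "'k::real_or_complex \<Rightarrow> 'h::banach \<Rightarrow> 'h" +
  fixes ip :: "'h \<Rightarrow> 'h \<Rightarrow> 'k"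
  assumes smul_of_real: "smul (of_real r) x = r *\<^sub>R x"
    and ip_add_left: "ip (x + y) z = ip x z + ip y z"
    and ip_smul_left: "ip (smul c x) y = c * ip x y"
    and ip_commute: "ip y x = scalar_cnj (ip x y)"
    and ip_self: "ip x x = of_real ((norm x)\<^sup>2)"

lemma hilbert_space_real:
  "hilbert_space scaleR (inner :: 'h::{real_inner,banach} \<Rightarrow> 'h \<Rightarrow> real)"
  by unfold_locales
    (auto simp: scalar_cnj_real_def inner_simps inner_commute power2_norm_eq_inner
      scaleR_add_right scaleR_add_left)

lemma hilbert_space_complex:
  "hilbert_space (*) (\<lambda>x y. x * cnj y)"
  by unfold_locales
    (auto simp: scalar_cnj_complex_def complex_norm_square[symmetric] scaleR_conv_of_real
      algebra_simps)

text \<open>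
  An operator in \<open>'h\<close> is a partial map \<open>'h \<rightharpoonup> 'h\<close>, so that equality of operators includes
  equality of domains. Domain, range and graph are those of \<open>Map\<close>, and \<open>\<circ>\<^sub>m\<close> is the
  product with its natural domain.
\<close>

definition linear_operator :: "('k::real_or_complex \<Rightarrow> 'h::banach \<Rightarrow> 'h) \<Rightarrow> ('h \<rightharpoonup> 'h) \<Rightarrow> bool" where
  "linear_operator smul S \<longleftrightarrow>
     module.subspace smul (dom S) \<and>
     (\<forall>x\<in>dom S. \<forall>y\<in>dom S. the (S (x + y)) = the (S x) + the (S y)) \<and>
     (\<forall>c. \<forall>x\<in>dom S. the (S (smul c x)) = smul c (the (S x)))"

definition op_plus :: "('h::plus \<rightharpoonup> 'h) \<Rightarrow> ('h \<rightharpoonup> 'h) \<Rightarrow> ('h \<rightharpoonup> 'h)" where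
  "op_plus S T = (\<lambda>h. if h \<in> dom S \<inter> dom T then Some (the (S h) + the (T h)) else None)"

definition symmetric_operator :: "('h \<Rightarrow> 'h \<Rightarrow> 'k) \<Rightarrow> ('h \<rightharpoonup> 'h) \<Rightarrow> bool" where
  "symmetric_operator ip S \<longleftrightarrow>
     (\<forall>h\<in>dom S. \<forall>h'\<in>dom S. ip (the (S h)) h' = ip h (the (S h')))"

definition densely_defined :: "('h::topological_space \<rightharpoonup> 'h) \<Rightarrow> bool" where
  "densely_defined S \<longleftrightarrow> closure (dom S) = UNIV"

text \<open>
  The value is determined by the condition only when \<open>S\<close> is densely defined;
  \<open>selfadjoint_operator\<close> requires that separately.
\<close>

definition adjoint_operator :: "('h \<Rightarrow> 'h \<Rightarrow> 'k) \<Rightarrow> ('h \<rightharpoonup> 'h) \<Rightarrow> ('h \<rightharpoonup> 'h)" where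
  "adjoint_operator ip S =
     (\<lambda>k. if \<exists>k'. \<forall>h\<in>dom S. ip (the (S h)) k = ip h k'
          then Some (THE k'. \<forall>h\<in>dom S. ip (the (S h)) k = ip h k')
          else None)"

definition selfadjoint_operator :: "('h::topological_space \<Rightarrow> 'h \<Rightarrow> 'k) \<Rightarrow> ('h \<rightharpoonup> 'h) \<Rightarrow> bool" where
  "selfadjoint_operator ip S \<longleftrightarrow> densely_defined S \<and> adjoint_operator ip S = S"

definition prod_ip :: "('h \<Rightarrow> 'h \<Rightarrow> 'k::plus) \<Rightarrow> 'h \<times> 'h \<Rightarrow> 'h \<times> 'h \<Rightarrow> 'k" where
  "prod_ip ip u v = ip (fst u) (fst v) + ip (snd u) (snd v)"

definition orth_compl :: "('v \<Rightarrow> 'v \<Rightarrow> 'k::zero) \<Rightarrow> 'v set \<Rightarrow> 'v set" where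
  "orth_compl ip A = {u. \<forall>v\<in>A. ip u v = 0}"

definition M_operator :: "('h::ab_group_add \<rightharpoonup> 'h) \<Rightarrow> ('h \<rightharpoonup> 'h) \<Rightarrow> ('h \<times> 'h \<rightharpoonup> 'h \<times> 'h)" where
  "M_operator S T =
     (\<lambda>(h, k). if h \<in> dom S \<and> k \<in> dom T then Some (h - the (T k), the (S h) + k) else None)"

end

theory Submission imports Defs begin

text \<open>
  Everything rests on orthogonal projection, in \<open>H\<close> and in \<open>H \<times> H\<close>. Symmetry of \<open>S\<close> makes every
  \<open>(-Sk, k)\<close> orthogonal to the graph of \<open>S\<close>, and \<open>ran M\<^sub>S\<^sub>,\<^sub>S\<close> is the sum of the graph and these
  vectors. If \<open>S\<close> is selfadjoint, its graph is closed and the vectors \<open>(-Sk, k)\<close> fill the orthogonal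
  complement, so \<open>ran M\<^sub>S\<^sub>,\<^sub>S\<close> is everything; conversely, if the complement lies in \<open>ran M\<^sub>S\<^sub>,\<^sub>S\<close>, it
  consists of such vectors, which says that \<open>S\<close> is densely defined with \<open>S\<^sup>* = S\<close>. The identities
  \<open>M(h, -Sh) = (h + S\<^sup>2h, 0)\<close> and \<open>M(Sk, k) = (0, k + S\<^sup>2k)\<close> relate this to the range of
  \<open>I + S\<^sup>2\<close>. Surjectivity of \<open>I + S\<^sup>2\<close> makes the symmetric operator \<open>S\<^sup>2\<close> selfadjoint. If \<open>S\<^sup>2\<close> is
  selfadjoint, the first component of the projection of \<open>(z, 0)\<close> onto the closure of
  \<open>{(h, Sh) | h \<in> dom S\<^sup>2}\<close> solves \<open>h + S\<^sup>2h = z\<close>.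
\<close>

section \<open>Conjugation of scalars\<close>

lemma scalar_cnj_0: "scalar_cnj (0::'k::real_or_complex) = 0"
  using scalar_cnj_add[of "0::'k" 0] by simp

lemma scalar_cnj_minus: "scalar_cnj (- x) = - scalar_cnj (x::'k::real_or_complex)"
  using scalar_cnj_add[of x "- x"] by (simp add: scalar_cnj_0 eq_neg_iff_add_eq_0 add.commute)

lemma scalar_cnj_of_real: "scalar_cnj (of_real r :: 'k::real_or_complex) = of_real r"
proof (cases "r = 0")
  case False
  have "of_real r * scalar_cnj (of_real r :: 'k) = of_real r * of_real r"
    using scalar_mult_cnj[of "of_real r :: 'k"] by (simp add: scaleR_conv_of_real power2_eq_square flip: of_real_mult)
  with False show ?thesis by simp
qed (simp add: scalar_cnj_0)

section \<open>Inner product calculus and the Cauchy-Schwarz inequality\<close>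

context hilbert_space
begin

lemma ip_zero_left: "ip 0 y = 0"
  using ip_add_left[of 0 0 y] by simp

lemma ip_minus_left: "ip (- x) y = - ip x y"
  using ip_add_left[of x "- x" y] by (simp add: ip_zero_left eq_neg_iff_add_eq_0 add.commute)

lemma ip_diff_left: "ip (x - y) z = ip x z - ip y z"
  using ip_add_left[of x "- y" z] by (simp add: ip_minus_left)

lemma ip_zero_right: "ip y 0 = 0"
  by (subst ip_commute) (simp add: ip_zero_left scalar_cnj_0)

lemma ip_add_right: "ip z (x + y) = ip z x + ip z y"
  by (metis ip_commute ip_add_left scalar_cnj_add)

lemma ip_minus_right: "ip z (- x) = - ip z x"
  by (metis ip_commute ip_minus_left scalar_cnj_minus)

lemma ip_diff_right: "ip z (x - y) = ip z x - ip z y"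
  using ip_add_right[of z x "- y"] by (simp add: ip_minus_right)

lemma ip_smul_right: "ip x (smul c y) = scalar_cnj c * ip x y"
  by (metis ip_commute ip_smul_left scalar_cnj_mult)

lemmas ip_simps = ip_zero_left ip_minus_left ip_add_left ip_diff_left ip_smul_left
  ip_zero_right ip_minus_right ip_add_right ip_diff_right ip_smul_right

lemma ip_mult_ip: "ip x y * ip y x = of_real ((norm (ip x y))\<^sup>2)"
  using scalar_mult_cnj[of "ip x y"] by (simp add: ip_commute[of y x] scaleR_conv_of_real)

text \<open>Inner products live in the scalar field, so the identity is expanded there and carried
  back to the reals by injectivity of \<open>of_real\<close>.\<close>

lemma parallelogram:
  fixes x y :: 'h
  shows "(norm (x + y))\<^sup>2 + (norm (x - y))\<^sup>2 = 2 * (norm x)\<^sup>2 + 2 * (norm y)\<^sup>2"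
proof -
  have "(of_real ((norm (x + y))\<^sup>2 + (norm (x - y))\<^sup>2) :: 'k) = of_real (2 * (norm x)\<^sup>2 + 2 * (norm y)\<^sup>2)"
    by (simp only: of_real_add of_real_mult ip_self[symmetric]) (simp add: ip_simps algebra_simps)
  then show ?thesis by (simp only: of_real_eq_iff)
qed

text \<open>The coefficient \<open>ip u b\<close> makes both cross terms real, so one real parameter
  \<open>t\<close> serves the real and the complex case. Cauchy-Schwarz and the variational step of
  the projection both use this quadratic in \<open>t\<close>.\<close>

lemma norm_diff_smul_ip:
  "(norm (u - smul (of_real t * ip u b) b))\<^sup>2
    = (norm u)\<^sup>2 - 2 * t * (norm (ip u b))\<^sup>2 + t\<^sup>2 * (norm (ip u b))\<^sup>2 * (norm b)\<^sup>2"
proof -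
  let ?c = "of_real t * ip u b"
  have c: "scalar_cnj ?c = of_real t * ip b u"
    by (simp add: scalar_cnj_mult scalar_cnj_of_real ip_commute[of b u])
  have "(of_real ((norm (u - smul ?c b))\<^sup>2) :: 'k)
      = ip u u - 2 * of_real t * (ip u b * ip b u) + of_real t ^ 2 * (ip u b * ip b u) * ip b b"
    by (simp only: ip_self[symmetric]) (simp add: ip_simps c algebra_simps power2_eq_square)
  also have "\<dots> = of_real ((norm u)\<^sup>2 - 2 * t * (norm (ip u b))\<^sup>2 + t\<^sup>2 * (norm (ip u b))\<^sup>2 * (norm b)\<^sup>2)"
    by (simp add: ip_mult_ip ip_self)
  finally show ?thesis by (simp only: of_real_eq_iff)
qed

lemma norm_ip_le: "norm (ip x y) \<le> norm x * norm y"
proof (cases "y = 0")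
  case False
  have "0 \<le> (norm x)\<^sup>2 - (norm (ip x y))\<^sup>2 / (norm y)\<^sup>2"
  proof -
    \<comment> \<open>The quadratic in \<open>t\<close> is taken at its minimum,
      \<open>t = 1 / (norm y)^2\<close>.\<close>
    have "0 \<le> (norm x)\<^sup>2 - 2 * (1 / (norm y)\<^sup>2) * (norm (ip x y))\<^sup>2
        + (1 / (norm y)\<^sup>2)\<^sup>2 * (norm (ip x y))\<^sup>2 * (norm y)\<^sup>2"
      unfolding norm_diff_smul_ip[symmetric] by (rule zero_le_power2)
    also have "\<dots> = (norm x)\<^sup>2 - (norm (ip x y))\<^sup>2 / (norm y)\<^sup>2"
      using False by (simp add: field_simps)
    finally show ?thesis .
  qed
  with False have "(norm (ip x y))\<^sup>2 \<le> (norm x * norm y)\<^sup>2"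
    by (simp add: field_simps power_mult_distrib)
  then show ?thesis by (rule power2_le_imp_le) simp
qed (simp add: ip_simps)

section \<open>Orthogonality, density and orthogonal projection\<close>

lemma closure_orthogonal:
  assumes "x \<in> closure A" and "\<And>a. a \<in> A \<Longrightarrow> ip a z = 0"
  shows "ip x z = 0"
proof (rule ccontr)
  assume nz: "ip x z \<noteq> 0"
  then have "z \<noteq> 0" by (auto simp: ip_simps)
  \<comment> \<open>The distance is chosen so that Cauchy-Schwarz bounds
    \<open>norm (ip x z)\<close> strictly by itself.\<close>
  then obtain a where a: "a \<in> A" "dist a x < norm (ip x z) / norm z"
    using assms(1) nz unfolding closure_approachable by (metis divide_pos_pos zero_less_norm_iff)
  have "norm (ip x z) = norm (ip (x - a) z)"
    using assms(2)[OF a(1)] by (simp add: ip_simps)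
  also have "\<dots> \<le> norm (x - a) * norm z" by (rule norm_ip_le)
  also have "\<dots> < norm (ip x z)"
    using a(2) \<open>z \<noteq> 0\<close> by (simp add: dist_norm norm_minus_commute pos_less_divide_eq)
  finally show False by simp
qed

lemma dense_orthogonal:
  assumes "closure A = UNIV" and "\<And>a. a \<in> A \<Longrightarrow> ip a z = 0"
  shows "z = 0"
  using closure_orthogonal[of z A z] assms by (simp add: ip_self)

text \<open>The distance from \<open>x\<close> to \<open>A\<close> is attained in
  \<open>closure A\<close>: the parallelogram law makes a minimising sequence Cauchy. Moving its
  limit along \<open>b\<close> cannot decrease the distance, which forces orthogonality.\<close>

lemma orthogonal_projection:
  assumes "subspace A"
  obtains a where "a \<in> closure A" and "\<And>b. b \<in> A \<Longrightarrow> ip (x - a) b = 0"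
proof -
  define d where "d = (INF a\<in>A. (norm (x - a))\<^sup>2)"
  have ne: "A \<noteq> {}" using assms subspace_0 by blast
  have bdd: "bdd_below ((\<lambda>a. (norm (x - a))\<^sup>2) ` A)" by (rule bdd_belowI2[of _ 0]) simp
  have d: "d \<le> (norm (x - a))\<^sup>2" if "a \<in> A" for a
    unfolding d_def using bdd that by (rule cINF_lower)
  have "\<exists>a\<in>A. (norm (x - a))\<^sup>2 < d + 1 / real (Suc n)" for n
    using cINF_less_iff[OF ne bdd, of "d + 1 / real (Suc n)"] unfolding d_def by simp
  then obtain s where s: "\<And>n. s n \<in> A" and sd: "\<And>n. (norm (x - s n))\<^sup>2 < d + 1 / real (Suc n)"
    by metis
  \<comment> \<open>Midpoints stay in \<open>A\<close>; the parallelogram law then bounds the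
    distance of two nearly optimal points.\<close>
  have half: "d \<le> (norm (x - (1/2) *\<^sub>R (a + b)))\<^sup>2" if "a \<in> A" "b \<in> A" for a b
  proof (rule d)
    have "smul (of_real (1/2)) (a + b) \<in> A"
      using assms that by (intro subspace_scale subspace_add)
    then show "(1/2) *\<^sub>R (a + b) \<in> A" by (simp only: smul_of_real)
  qed
  have close: "(norm (a - b))\<^sup>2 \<le> 2 * (norm (x - a))\<^sup>2 + 2 * (norm (x - b))\<^sup>2 - 4 * d"
    if "a \<in> A" "b \<in> A" for a b
  proof -
    have "(x - a) + (x - b) = 2 *\<^sub>R (x - (1/2) *\<^sub>R (a + b))"
      by (simp add: algebra_simps scaleR_2)
    then have "(norm ((x - a) + (x - b)))\<^sup>2 = 4 * (norm (x - (1/2) *\<^sub>R (a + b)))\<^sup>2"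
      by (simp add: power_mult_distrib)
    moreover have "(norm ((x - a) - (x - b)))\<^sup>2 = (norm (a - b))\<^sup>2"
      by (simp add: norm_minus_commute)
    ultimately show ?thesis
      using parallelogram[of "x - a" "x - b"] half[OF that] by linarith
  qed
  have "Cauchy s"
  proof (rule metric_CauchyI)
    fix e :: real assume e: "0 < e"
    \<comment> \<open>By \<open>close\<close>, squared distances beyond \<open>N\<close> are below
      \<open>4 / (N + 1)\<close>; hence the quarter.\<close>
    obtain N where N: "1 / real (Suc N) < e\<^sup>2 / 4"
      using nat_approx_posE[of "e\<^sup>2 / 4"] e by auto
    have "dist (s m) (s n) < e" if mn: "N \<le> m" "N \<le> n" for m n
    proof -
      have "1 / real (Suc m) \<le> 1 / real (Suc N)" "1 / real (Suc n) \<le> 1 / real (Suc N)"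
        using mn by (simp_all add: frac_le)
      then have "(norm (s m - s n))\<^sup>2 < e\<^sup>2"
        using close[OF s s, of m n] sd[of m] sd[of n] N by linarith
      then show ?thesis using e by (simp add: dist_norm power2_less_imp_less)
    qed
    then show "\<exists>M. \<forall>m\<ge>M. \<forall>n\<ge>M. dist (s m) (s n) < e" by blast
  qed
  then obtain a where lim: "s \<longlonglongrightarrow> a" using Cauchy_convergent_iff convergent_def by blast
  have ain: "a \<in> closure A" using s lim closure_sequential by blast
  have up: "(norm (x - a))\<^sup>2 \<le> d"
  proof (rule LIMSEQ_le)
    show "(\<lambda>n. (norm (x - s n))\<^sup>2) \<longlonglongrightarrow> (norm (x - a))\<^sup>2" by (intro tendsto_intros lim)
    have "(\<lambda>n. d + 1 / real (Suc n)) \<longlonglongrightarrow> d + 0"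
      by (intro tendsto_intros LIMSEQ_Suc lim_1_over_n)
    then show "(\<lambda>n. d + 1 / real (Suc n)) \<longlonglongrightarrow> d" by simp
    show "\<exists>N. \<forall>n\<ge>N. (norm (x - s n))\<^sup>2 \<le> d + 1 / real (Suc n)"
      using sd less_imp_le by blast
  qed
  \<comment> \<open>The limit \<open>a\<close> may lie outside \<open>A\<close>, but each
    \<open>s n + b\<close> is in \<open>A\<close>, so the bound by \<open>d\<close> passes to the
    limit.\<close>
  have low: "d \<le> (norm (x - a - b))\<^sup>2" if "b \<in> A" for b
  proof (rule LIMSEQ_le_const)
    show "(\<lambda>n. (norm (x - s n - b))\<^sup>2) \<longlonglongrightarrow> (norm (x - a - b))\<^sup>2" by (intro tendsto_intros lim)
    show "\<exists>N. \<forall>n\<ge>N. d \<le> (norm (x - s n - b))\<^sup>2"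
      using d[OF subspace_add[OF assms s that]] by (simp add: diff_diff_eq)
  qed
  have "ip (x - a) b = 0" if b: "b \<in> A" for b
  proof -
    define p where "p = (norm (ip (x - a) b))\<^sup>2"
    define B where "B = (norm b)\<^sup>2"
    \<comment> \<open>This \<open>t\<close> is positive even for \<open>b = 0\<close> and satisfies
      \<open>t * B \<le> 1\<close>, so the quadratic term absorbs at most half of
      \<open>2 * t * p\<close>.\<close>
    define t where "t = 1 / (1 + B)"
    have B: "0 \<le> B" by (simp add: B_def)
    have "(norm (x - a))\<^sup>2 \<le> (norm (x - a))\<^sup>2 - 2 * t * p + t\<^sup>2 * p * B"
      using up low[OF subspace_scale[OF assms b, of "of_real t * ip (x - a) b"]]
      unfolding norm_diff_smul_ip p_def B_def by linarith
    moreover have "t\<^sup>2 * p * B \<le> t * p"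
    proof -
      have "t * B \<le> 1" "0 \<le> t * p" using B by (simp_all add: t_def p_def)
      then show ?thesis using mult_right_mono[of "t * B" 1 "t * p"] by (simp add: power2_eq_square mult_ac)
    qed
    ultimately have "t * p \<le> 0" by linarith
    moreover have "0 < t" using B by (simp add: t_def)
    ultimately have "p \<le> 0" by (simp add: mult_le_0_iff)
    then show ?thesis by (simp add: p_def)
  qed
  with ain show ?thesis by (rule that)
qed

text \<open>The residual of each projection onto \<open>closure A\<close> is orthogonal to
  \<open>A\<close>, hence zero.\<close>

lemma dense_if_orthogonal_trivial:
  assumes "subspace A" and "\<And>z. (\<And>a. a \<in> A \<Longrightarrow> ip z a = 0) \<Longrightarrow> z = 0"
  shows "closure A = UNIV"
proof -
  have "x \<in> closure A" for x
  proof -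
    obtain a where "a \<in> closure A" "\<And>b. b \<in> A \<Longrightarrow> ip (x - a) b = 0"
      by (rule orthogonal_projection[OF assms(1), of x]) blast
    with assms(2)[of "x - a"] show ?thesis by simp
  qed
  then show ?thesis by auto
qed

section \<open>The product space and selfadjointness in terms of graphs\<close>

lemma hilbert_space_prod:
  "hilbert_space (\<lambda>c u. (smul c (fst u), smul c (snd u))) (prod_ip ip)"
proof unfold_locales
  fix x y :: "'h \<times> 'h"
  show "prod_ip ip y x = scalar_cnj (prod_ip ip x y)"
    unfolding prod_ip_def scalar_cnj_add by (metis ip_commute)
\<comment> \<open>The library norm on pairs is Euclidean, which is what \<open>ip_self\<close>
  demands of \<open>prod_ip\<close>.\<close>
qed (simp_all add: prod_ip_def scale_right_distrib scale_left_distrib smul_of_real ip_add_left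
    ip_smul_left distrib_left ip_self norm_prod_def prod_eq_iff)

text \<open>Density makes the vector selected by \<open>THE\<close> unique, so the adjoint can be
  replaced by its defining relation. Later proofs work with this form only.\<close>

lemma selfadjoint_operator_iff:
  "selfadjoint_operator ip T \<longleftrightarrow> closure (dom T) = UNIV \<and>
    (\<forall>k k'. T k = Some k' \<longleftrightarrow> (\<forall>h h'. T h = Some h' \<longrightarrow> ip h' k = ip h k'))"
proof (cases "closure (dom T) = UNIV")
  case True
  have unique: "k' = k''" if "\<forall>h\<in>dom T. ip (the (T h)) k = ip h k'" "\<forall>h\<in>dom T. ip (the (T h)) k = ip h k''" for k k' k''
    using dense_orthogonal[OF True, of "k' - k''"] that by (simp add: ip_simps)
  have "adjoint_operator ip T k = Some k' \<longleftrightarrow> (\<forall>h\<in>dom T. ip (the (T h)) k = ip h k')" for k k'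
  proof -
    have "(THE k'. \<forall>h\<in>dom T. ip (the (T h)) k = ip h k') = l" if "\<forall>h\<in>dom T. ip (the (T h)) k = ip h l" for l
      using that unique by (intro the_equality) blast+
    then show ?thesis
      unfolding adjoint_operator_def by (smt (verit) option.distinct(1) option.inject)
  qed
  moreover have adjoint_cond: "(\<forall>h\<in>dom T. ip (the (T h)) k = ip h k') \<longleftrightarrow> (\<forall>h h'. T h = Some h' \<longrightarrow> ip h' k = ip h k')" for k k'
    by (auto simp: dom_def)
  moreover have "adjoint_operator ip T = T \<longleftrightarrow> (\<forall>k k'. adjoint_operator ip T k = Some k' \<longleftrightarrow> T k = Some k')"
    by (metis ext option.exhaust)
  ultimately show ?thesis
    by (simp only: selfadjoint_operator_def densely_defined_def True simp_thms adjoint_cond)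
      meson
qed (simp add: selfadjoint_operator_def densely_defined_def)

end

section \<open>Symmetric linear operators and the ranges in terms of graphs\<close>

locale symmetric_linear_operator = hilbert_space smul ip
  for smul :: "'k::real_or_complex \<Rightarrow> 'h::banach \<Rightarrow> 'h" and ip +
  fixes S :: "'h \<rightharpoonup> 'h"
  assumes linear: "linear_operator smul S"
    and symmetric: "symmetric_operator ip S"
begin

lemma S_add:
  assumes "S x = Some x'" and "S y = Some y'"
  shows "S (x + y) = Some (x' + y')"
proof -
  have "x \<in> dom S" "y \<in> dom S" using assms by auto
  then have "x + y \<in> dom S" "the (S (x + y)) = x' + y'"
    using linear assms subspace_add unfolding linear_operator_def by auto
  then show ?thesis by auto
qed

lemma S_smul:
  assumes "S x = Some x'"
  shows "S (smul c x) = Some (smul c x')"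
proof -
  have "x \<in> dom S" using assms by auto
  then have "smul c x \<in> dom S" "the (S (smul c x)) = smul c x'"
    using linear assms subspace_scale unfolding linear_operator_def by auto
  then show ?thesis by auto
qed

lemma S_0: "S 0 = Some 0"
proof -
  have "0 \<in> dom S" using linear subspace_0 unfolding linear_operator_def by blast
  then obtain z where "S 0 = Some z" by blast
  from S_smul[OF this, of 0] show ?thesis by simp
qed

lemma S_minus: "S x = Some x' \<Longrightarrow> S (- x) = Some (- x')"
  using S_smul[of x x' "- 1"] by simp

lemma S_diff: "S x = Some x' \<Longrightarrow> S y = Some y' \<Longrightarrow> S (x - y) = Some (x' - y')"
  using S_add[OF _ S_minus] by fastforce

lemma S_symmetric: "S x = Some x' \<Longrightarrow> S y = Some y' \<Longrightarrow> ip x' y = ip x y'"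
  using symmetric unfolding symmetric_operator_def by (metis domI option.sel)

lemma S_comp_S: "(S \<circ>\<^sub>m S) h = Some h'' \<longleftrightarrow> (\<exists>h'. S h = Some h' \<and> S h' = Some h'')"
  by (auto simp: map_comp_def split: option.split)

lemma ran_M: "ran (M_operator S S) = {(h - k', h' + k) |h h' k k'. S h = Some h' \<and> S k = Some k'}"
  unfolding ran_def M_operator_def by (force split: if_splits)

lemma ran_I_plus_S2: "ran (op_plus Some (S \<circ>\<^sub>m S)) = {h + h'' |h h' h''. S h = Some h' \<and> S h' = Some h''}"
  unfolding ran_def op_plus_def by (force simp: S_comp_S split: if_splits)

section \<open>Selfadjointness of S and the range of M\<close>

lemma ran_M_UNIV_if_selfadjoint:
  assumes sa: "selfadjoint_operator ip S"
  shows "ran (M_operator S S) = UNIV"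
proof -
  interpret P: hilbert_space "\<lambda>c u. (smul c (fst u), smul c (snd u))" "prod_ip ip"
    by (rule hilbert_space_prod)
  have adj: "S k = Some k'" if "\<And>h h'. S h = Some h' \<Longrightarrow> ip h' k = ip h k'" for k k'
    using sa that unfolding selfadjoint_operator_iff by blast
  have sub: "P.subspace (Map.graph S)"
    by (rule P.subspaceI) (auto simp: Map.graph_def zero_prod_def S_0 S_add S_smul)
  have "w \<in> ran (M_operator S S)" for w
  proof -
    obtain a where a: "a \<in> closure (Map.graph S)"
      and orth: "\<And>b. b \<in> Map.graph S \<Longrightarrow> prod_ip ip (w - a) b = 0"
      by (rule P.orthogonal_projection[OF sub, of w]) blast
    \<comment> \<open>The graph is closed: orthogonality to every \<open>(- h', h)\<close> passes
      from the graph to \<open>a\<close> and is exactly the adjoint relation for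
      \<open>a\<close>.\<close>
    have Sa: "S (fst a) = Some (snd a)"
    proof (rule adj)
      fix h h' assume h: "S h = Some h'"
      have "prod_ip ip a (- h', h) = 0"
        using a by (rule P.closure_orthogonal) (auto simp: prod_ip_def Map.graph_def ip_simps S_symmetric[OF _ h])
      then have "ip (snd a) h = ip (fst a) h'"
        by (simp add: prod_ip_def ip_simps)
      then show "ip h' (fst a) = ip h (snd a)"
        by (metis ip_commute)
    qed
    \<comment> \<open>Orthogonality of \<open>w - a\<close> to the graph is the adjoint relation for
      its second component, with the sign of the first reversed.\<close>
    have "S (snd (w - a)) = Some (- fst (w - a))"
    proof (rule adj)
      fix h h' assume "S h = Some h'"
      then have "prod_ip ip (w - a) (h, h') = 0" by (intro orth) (simp add: Map.graph_def)
      then have "ip (snd (w - a)) h' = ip (- fst (w - a)) h"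
        unfolding ip_minus_left eq_neg_iff_add_eq_0 by (simp add: prod_ip_def add.commute)
      then show "ip h' (snd (w - a)) = ip h (- fst (w - a))"
        by (metis ip_commute)
    qed
    moreover have "w = (fst a - - fst (w - a), snd a + snd (w - a))"
      by (simp add: prod_eq_iff)
    ultimately show ?thesis
      unfolding ran_M using Sa by blast
  qed
  then show ?thesis by blast
qed

lemma selfadjoint_if_orth_compl_subset:
  assumes sub: "orth_compl (prod_ip ip) (Map.graph S) \<subseteq> ran (M_operator S S)"
  shows "selfadjoint_operator ip S"
proof -
  have perp: "S v = Some (- u)"
    if uv: "\<And>h h'. S h = Some h' \<Longrightarrow> ip u h + ip v h' = 0" for u v
  proof -
    have "(u, v) \<in> orth_compl (prod_ip ip) (Map.graph S)"
      using uv by (auto simp: orth_compl_def prod_ip_def Map.graph_def)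
    then obtain h h' k k' where hk: "S h = Some h'" "S k = Some k'" "u = h - k'" "v = h' + k"
      using sub unfolding ran_M by blast
    \<comment> \<open>Pairing \<open>(u, v)\<close> with its own graph part \<open>(h, h')\<close>
      cancels \<open>(- k', k)\<close> by symmetry and leaves the squared norm of
      \<open>(h, h')\<close>.\<close>
    have "ip h h + ip h' h' = 0"
      using uv[OF hk(1)] S_symmetric[OF hk(2) hk(1)] hk(3,4) by (simp add: ip_simps)
    then have "(of_real ((norm h)\<^sup>2 + (norm h')\<^sup>2) :: 'k) = 0"
      by (simp add: ip_self)
    then have "h = 0" "h' = 0"
      by (simp_all only: of_real_eq_0_iff sum_power2_eq_zero_iff norm_eq_zero)
    with hk show ?thesis by simp
  qed
  have "closure (dom S) = UNIV"
  proof (rule dense_if_orthogonal_trivial)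
    show "subspace (dom S)" using linear by (simp add: linear_operator_def)
    \<comment> \<open>If \<open>z\<close> is orthogonal to the domain, \<open>(z, 0)\<close> is
      orthogonal to the graph, so \<open>S 0 = Some (- z)\<close>.\<close>
    show "z = 0" if "\<And>a. a \<in> dom S \<Longrightarrow> ip z a = 0" for z
      using perp[of z 0] that by (auto simp: ip_simps S_0 domI)
  qed
  moreover have "S k = Some k'" if "\<And>h h'. S h = Some h' \<Longrightarrow> ip h' k = ip h k'" for k k'
  proof -
    \<comment> \<open>The adjoint relation for \<open>k\<close> and \<open>k'\<close> puts
      \<open>(- k', k)\<close> in the orthogonal complement of the graph.\<close>
    have "ip (- k') h + ip k h' = 0" if "S h = Some h'" for h h'
    proof -
      have "ip k h' = ip k' h" using \<open>\<And>h h'. S h = Some h' \<Longrightarrow> ip h' k = ip h k'\<close>[OF that] by (metis ip_commute)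
      then show ?thesis by (simp add: ip_simps)
    qed
    from perp[OF this] show ?thesis by simp
  qed
  ultimately show ?thesis
    unfolding selfadjoint_operator_iff using S_symmetric by blast
qed

section \<open>The range of M and the range of I + S^2\<close>

lemma ran_M_UNIV_iff: "ran (M_operator S S) = UNIV \<longleftrightarrow> ran (op_plus Some (S \<circ>\<^sub>m S)) = UNIV"
proof
  assume M: "ran (M_operator S S) = UNIV"
  have "z \<in> ran (op_plus Some (S \<circ>\<^sub>m S))" for z
  proof -
    \<comment> \<open>The second component 0 forces \<open>k = - h'\<close>, so \<open>h'\<close>
      lies in the domain of \<open>S\<close> and the first component becomes
      \<open>h + S^2 h\<close>.\<close>
    have "(z, 0) \<in> ran (M_operator S S)" by (simp add: M)
    then obtain h h' k k' where hk: "S h = Some h'" "S k = Some k'" "z = h - k'" "h' + k = 0"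
      unfolding ran_M by auto
    then have "S h' = Some (- k')"
      using S_minus[OF hk(2)] by (simp add: eq_neg_iff_add_eq_0[symmetric])
    moreover have "z = h + (- k')" using hk by simp
    ultimately show ?thesis
      unfolding ran_I_plus_S2 using hk(1) by blast
  qed
  then show "ran (op_plus Some (S \<circ>\<^sub>m S)) = UNIV" by blast
next
  assume R: "ran (op_plus Some (S \<circ>\<^sub>m S)) = UNIV"
  have "(x, y) \<in> ran (M_operator S S)" for x y
  proof -
    have "x \<in> ran (op_plus Some (S \<circ>\<^sub>m S))" "y \<in> ran (op_plus Some (S \<circ>\<^sub>m S))" by (simp_all add: R)
    then obtain h h' h'' k k' k'' where h: "S h = Some h'" "S h' = Some h''" "x = h + h''"
      and k: "S k = Some k'" "S k' = Some k''" "y = k + k''"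
      unfolding ran_I_plus_S2 by blast
    \<comment> \<open>The preimage of \<open>(x, y)\<close> is the sum of the preimage
      \<open>(h, - h')\<close> of \<open>(x, 0)\<close> and the preimage \<open>(k', k)\<close> of
      \<open>(0, y)\<close>.\<close>
    have "S (h + k') = Some (h' + k'')" "S (k - h') = Some (k' - h'')"
      using h k S_add S_diff by blast+
    moreover have "(x, y) = ((h + k') - (k' - h''), (h' + k'') + (k - h'))" using h k by simp
    ultimately show ?thesis unfolding ran_M by blast
  qed
  then show "ran (M_operator S S) = UNIV" by auto
qed

section \<open>Selfadjointness of S^2 and the range of I + S^2\<close>

lemma S2_symmetric:
  assumes "(S \<circ>\<^sub>m S) h = Some h'" and "(S \<circ>\<^sub>m S) k = Some k'"
  shows "ip h' k = ip h k'"
  using assms unfolding S_comp_S by (metis S_symmetric)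

lemma subspace_dom_S2: "subspace (dom (S \<circ>\<^sub>m S))"
proof (rule subspaceI)
  show "0 \<in> dom (S \<circ>\<^sub>m S)"
    by (rule domI) (simp add: S_comp_S S_0)
  show "x + y \<in> dom (S \<circ>\<^sub>m S)" if "x \<in> dom (S \<circ>\<^sub>m S)" "y \<in> dom (S \<circ>\<^sub>m S)" for x y
    using that unfolding dom_def by (simp add: S_comp_S) (meson S_add)
  show "smul c x \<in> dom (S \<circ>\<^sub>m S)" if "x \<in> dom (S \<circ>\<^sub>m S)" for c x
    using that unfolding dom_def by (simp add: S_comp_S) (meson S_smul)
qed

lemma S2_selfadjoint_if_surj:
  assumes R: "ran (op_plus Some (S \<circ>\<^sub>m S)) = UNIV"
  shows "selfadjoint_operator ip (S \<circ>\<^sub>m S)"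
proof -
  have surj: "\<exists>h h' h''. S h = Some h' \<and> S h' = Some h'' \<and> z = h + h''" for z
    using R unfolding ran_I_plus_S2 by blast
  have "closure (dom (S \<circ>\<^sub>m S)) = UNIV"
  proof (rule dense_if_orthogonal_trivial[OF subspace_dom_S2])
    fix z assume z: "\<And>a. a \<in> dom (S \<circ>\<^sub>m S) \<Longrightarrow> ip z a = 0"
    obtain h h' h'' where h: "S h = Some h'" "S h' = Some h''" "z = h + h''"
      using surj by blast
    have "h \<in> dom (S \<circ>\<^sub>m S)" using h by (auto simp: S_comp_S)
    \<comment> \<open>Testing \<open>z = h + S^2 h\<close> against \<open>h\<close> gives a sum of
      two squared norms, since \<open>ip h'' h = ip h' h'\<close> by symmetry.\<close>
    then have "ip h h + ip h'' h = 0" using z h(3) by (simp add: ip_simps flip: ip_add_left)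
    then have "(of_real ((norm h)\<^sup>2 + (norm h')\<^sup>2) :: 'k) = 0"
      using S_symmetric[OF h(2,1)] by (simp add: ip_self)
    then have "h = 0"
      by (simp only: of_real_eq_0_iff sum_power2_eq_zero_iff norm_eq_zero)
    with h show "z = 0" by (simp add: S_0)
  qed
  moreover have "(S \<circ>\<^sub>m S) k = Some k'"
    if k: "\<And>h h'. (S \<circ>\<^sub>m S) h = Some h' \<Longrightarrow> ip h' k = ip h k'" for k k'
  proof -
    \<comment> \<open>This \<open>h\<close> is the candidate for \<open>k\<close>: if
      \<open>S^2 k = k'\<close> is to hold, both solve the same equation.\<close>
    obtain h h' h'' where h: "S h = Some h'" "S h' = Some h''" "k + k' = h + h''"
      using surj by blast
    then have S2h: "(S \<circ>\<^sub>m S) h = Some h''" by (auto simp: S_comp_S)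
    \<comment> \<open>The difference \<open>k - h\<close> is orthogonal to the range of
      \<open>I + S^2\<close>; writing it as an element of that range makes it orthogonal to
      itself.\<close>
    obtain g g' g'' where g: "S g = Some g'" "S g' = Some g''" "k - h = g + g''"
      using surj by blast
    then have S2g: "(S \<circ>\<^sub>m S) g = Some g''" by (auto simp: S_comp_S)
    have "ip (g + g'') k = ip g (k + k')" using k[OF S2g] by (simp add: ip_simps)
    also have "\<dots> = ip (g + g'') h"
      using S2_symmetric[OF S2g S2h] by (simp add: h(3) ip_simps)
    finally have "ip (g + g'') (k - h) = 0" by (simp add: ip_diff_right)
    then have "k = h" by (simp add: ip_self flip: g(3))
    with h S2h show ?thesis by simp
  qed
  ultimately show ?thesis
    unfolding selfadjoint_operator_iff using S2_symmetric by blast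
qed

lemma surj_if_S2_selfadjoint:
  assumes sa: "selfadjoint_operator ip (S \<circ>\<^sub>m S)"
  shows "ran (op_plus Some (S \<circ>\<^sub>m S)) = UNIV"
proof -
  interpret P: hilbert_space "\<lambda>c u. (smul c (fst u), smul c (snd u))" "prod_ip ip"
    by (rule hilbert_space_prod)
  define A where "A = {(h, h') |h h' h''. S h = Some h' \<and> S h' = Some h''}"
  have AI: "(h, h') \<in> A" if "S h = Some h'" "S h' = Some h''" for h h' h''
    using that by (auto simp: A_def)
  have sub: "P.subspace A"
  proof (rule P.subspaceI)
    show "0 \<in> A" unfolding zero_prod_def by (rule AI) (rule S_0)+
    show "x + y \<in> A" if "x \<in> A" "y \<in> A" for x y
      using that unfolding A_def by clarsimp (meson S_add)
    show "(smul c (fst x), smul c (snd x)) \<in> A" if "x \<in> A" for c x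
      using that unfolding A_def by clarsimp (meson S_smul)
  qed
  have "z \<in> ran (op_plus Some (S \<circ>\<^sub>m S))" for z
  proof -
    obtain w where "w \<in> closure A" "\<And>b. b \<in> A \<Longrightarrow> prod_ip ip ((z, 0) - w) b = 0"
      by (rule P.orthogonal_projection[OF sub, of "(z, 0)"]) blast
    then obtain a b where ab: "(a, b) \<in> closure A"
      and orth: "\<And>u. u \<in> A \<Longrightarrow> prod_ip ip ((z, 0) - (a, b)) u = 0"
      by (cases w) blast
    \<comment> \<open>The vector \<open>b\<close> need not be identified with a value of
      \<open>S\<close>. Membership in \<open>closure A\<close> and orthogonality of the residual
      each express a pairing through \<open>ip b g'\<close>; eliminating it leaves the adjoint
      relation of \<open>S^2\<close> for \<open>a\<close> and \<open>z - a\<close>.\<close>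
    have "ip g'' a = ip g (z - a)" if "(S \<circ>\<^sub>m S) g = Some g''" for g g''
    proof -
      obtain g' where g: "S g = Some g'" "S g' = Some g''" using \<open>(S \<circ>\<^sub>m S) g = Some g''\<close> by (auto simp: S_comp_S)
      have "prod_ip ip (a, b) (g'', - g') = 0"
        using ab by (rule P.closure_orthogonal) (auto simp: A_def prod_ip_def ip_simps S_symmetric[OF _ g(2)])
      then have "ip a g'' = ip b g'" by (simp add: prod_ip_def ip_simps)
      moreover have "ip (z - a) g = ip b g'"
        using orth[OF AI[OF g]] by (simp add: prod_ip_def ip_simps)
      ultimately show ?thesis by (metis ip_commute)
    qed
    then have "(S \<circ>\<^sub>m S) a = Some (z - a)"
      using sa unfolding selfadjoint_operator_iff by blast
    then obtain a' where "S a = Some a'" "S a' = Some (z - a)" by (auto simp: S_comp_S)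
    moreover have "z = a + (z - a)" by simp
    ultimately show ?thesis unfolding ran_I_plus_S2 by blast
  qed
  then show ?thesis by blast
qed

end

theorem theorem6p3:
  fixes smul :: "'k::real_or_complex \<Rightarrow> 'h::banach \<Rightarrow> 'h"
    and ip :: "'h \<Rightarrow> 'h \<Rightarrow> 'k"
    and S :: "'h \<rightharpoonup> 'h"
  assumes "hilbert_space smul ip"
    and "linear_operator smul S"
    and "symmetric_operator ip S"
  shows "(selfadjoint_operator ip S \<longleftrightarrow> ran (M_operator S S) = UNIV)
       \<and> (selfadjoint_operator ip S \<longleftrightarrow> orth_compl (prod_ip ip) (Map.graph S) \<subseteq> ran (M_operator S S))
       \<and> (selfadjoint_operator ip S \<longleftrightarrow> ran (op_plus Some (S \<circ>\<^sub>m S)) = UNIV)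
       \<and> (selfadjoint_operator ip S \<longleftrightarrow> selfadjoint_operator ip (S \<circ>\<^sub>m S))"
proof -
  interpret symmetric_linear_operator smul ip S
    using assms by (intro symmetric_linear_operator.intro symmetric_linear_operator_axioms.intro)
  show ?thesis
    \<comment> \<open>The first three assertions form a cycle whose middle implication is trivial;
      the last two are joined to it through the range of \<open>I + S^2\<close>.\<close>
    using ran_M_UNIV_if_selfadjoint selfadjoint_if_orth_compl_subset ran_M_UNIV_iff
      S2_selfadjoint_if_surj surj_if_S2_selfadjoint
    by (metis subset_UNIV)
qed

end
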